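(* Let $\mathcal{T}$ be a finite rooted tree with root $\emptyset$. If the functions $\beta_H$, $H\in\mathcal{T}$, are continuous and non-decreasing, then there exists a unique solution $u=(u_H)_{H\in\mathcal{T}}\in\mathbb{R}_+^{\mathcal{T}}$ of the fixed point equation $$u_H=\sum_{G\in\mathcal{T},\ H\subseteq G}\phi_G\big(u_{[\emptyset,G]}\big),\qquad H\in\mathcal{T}.$$
   Context: $\mathbb{R}_+=[0,\infty)$. For nodes $H,G$ of the tree $\mathcal{T}$, $H\subseteq G$ means that $H$ is an ancestor of $G$ or $H=G$ (i.e. $H$ lies on the path from the root $\emptyset$ to $G$). For $G\in\mathcal{T}$, $u_{[\emptyset,G]}=(u_P)_{\emptyset\subseteq P\subseteq G}$ is the vector of coordinates of $u$ along the path from the root to $G$. Classes of connections are indexed by nodes: class $G$ starts at the root, follows the tree and leaves at $G$, thus using exactly the nodes $P$ with $\emptyset\subseteq P\subseteq G$; the allocation coefficient is $1$ if class $G$ uses a node and $0$ otherwise. For each $G\in\mathcal{T}$, $p_G$ is the proportion of class $G$ connections ($\sum_G p_G=1$), $a_G$ is a non-negative number (linear increase rate), $r_G\in(0,1)$ is the multiplicative decrease factor, and $\beta_G$ is a function with values in $\mathbb{R}_+$ of the vector $u_{[\emptyset,G]}$ with non-negative coordinates (loss rate function). The function $\phi_G$ is $$\phi_G(u_{[\emptyset,G]})=p_G\sqrt{\frac{2}{\pi}}\left(\prod_{n=1}^{\infty}\frac{1-r_G^{2n}}{1-r_G^{2n-1}}\right)\sqrt{\frac{a_G}{\beta_G(u_{[\emptyset,G]})}}.$$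 "Non-decreasing" means non-decreasing with respect to the coordinatewise partial order.
   Formalization: For each class G with p_G>0 and a_G>0 it is additionally assumed that β_G is not identically zero (otherwise φ_G is infinite everywhere and no solution exists); φ_G is read as ∞ where β_G vanishes, and as 0 if p_G=0 or a_G=0. *)

theory Defs
  imports "HOL-Analysis.Analysis"
begin

text \<open>A rooted tree, given by its set of nodes, its root and its (parent, child) relation;
  \<open>(H, G) \<in> E\<^sup>*\<close> says that \<open>H\<close> is an ancestor of \<open>G\<close> or \<open>H = G\<close>.\<close>

definition rooted_tree :: "'a set \<Rightarrow> 'a \<Rightarrow> ('a \<times> 'a) set \<Rightarrow> bool" where
  "rooted_tree T \<rho> E \<longleftrightarrow>
     \<rho> \<in> T \<and> E \<subseteq> T \<times> T \<and>
     (\<forall>P. (P, \<rho>) \<notin> E) \<and>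
     (\<forall>G\<in>T - {\<rho>}. \<exists>!P. (P, G) \<in> E) \<and>
     (\<forall>G\<in>T. (\<rho>, G) \<in> E\<^sup>*)"

definition root_path :: "('a \<times> 'a) set \<Rightarrow> 'a \<Rightarrow> 'a \<Rightarrow> 'a set" where
  "root_path E \<rho> G = {P. (\<rho>, P) \<in> E\<^sup>* \<and> (P, G) \<in> E\<^sup>*}"

definition esqrt :: "ennreal \<Rightarrow> ennreal" where
  "esqrt x = (if x = \<infinity> then \<infinity> else ennreal (sqrt (enn2real x)))"

text \<open>The loss rate may vanish, so \<open>phi\<close> takes values in \<open>[0, \<infinity>]\<close>: in \<^typ>\<open>ennreal\<close>,
  \<open>a / 0 = \<infinity>\<close> for \<open>a > 0\<close>, while \<open>0 / 0 = 0\<close> and \<open>0 * \<infinity> = 0\<close>. Thus a class with \<open>p = 0\<close>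
  or \<open>a = 0\<close> contributes nothing. The factors of the product are shifted to start at \<open>n = 0\<close>.\<close>

definition phi :: "real \<Rightarrow> real \<Rightarrow> real \<Rightarrow> (('a \<Rightarrow> real) \<Rightarrow> real) \<Rightarrow> ('a \<Rightarrow> real) \<Rightarrow> ennreal" where
  "phi p a r b v =
     ennreal (p * sqrt (2 / pi) * (\<Prod>n. (1 - r ^ (2 * n + 2)) / (1 - r ^ (2 * n + 1))))
       * esqrt (ennreal a / ennreal (b v))"

lemma phi_eq_real:
  assumes "a \<ge> 0" "b v > 0"
  shows "phi p a r b v =
    ennreal (p * sqrt (2 / pi) * (\<Prod>n. (1 - r ^ (2 * n + 2)) / (1 - r ^ (2 * n + 1)))
      * sqrt (a / b v))"
  using assms by (simp add: phi_def esqrt_def divide_ennreal ennreal_mult'')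

lemma phi_eq_0:
  assumes "p = 0 \<or> a = 0"
  shows "phi p a r b v = 0"
  using assms by (auto simp: phi_def esqrt_def)

lemma phi_product_pos:
  assumes "0 < r" "r < (1::real)"
  shows "convergent_prod (\<lambda>n. (1 - r ^ (2 * n + 2)) / (1 - r ^ (2 * n + 1)))"
    and "(\<Prod>n. (1 - r ^ (2 * n + 2)) / (1 - r ^ (2 * n + 1))) > 0"
proof -
  let ?f = "\<lambda>n. (1 - r ^ (2 * n + 2)) / (1 - r ^ (2 * n + 1))"
  have lt: "r ^ (2 * n + 1) \<le> r" "r ^ (2 * n + 2) < 1" for n
    using assms power_decreasing[of 1 "2*n+1" r] power_strict_decreasing[of 0 "2*n+2" r] by auto
  have ge: "0 \<le> ?f n - 1" and bd: "norm (?f n - 1) \<le> r ^ n" for n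
  proof -
    have eq: "?f n - 1 = r ^ (2 * n + 1) * (1 - r) / (1 - r ^ (2 * n + 1))"
    proof -
      have "1 - r ^ (2 * n + 1) \<noteq> 0" using lt(1)[of n] assms by linarith
      hence "?f n - 1 = (1 - r ^ (2 * n + 2) - (1 - r ^ (2 * n + 1))) / (1 - r ^ (2 * n + 1))"
        by (simp only: diff_divide_distrib divide_self_if if_False)
      thus ?thesis by (simp add: algebra_simps)
    qed
    have "(1 - r) / (1 - r ^ (2 * n + 1)) \<le> 1"
    proof -
      have d: "0 < 1 - r ^ (2 * n + 1)" using lt(1)[of n] assms by linarith
      show ?thesis unfolding divide_le_eq_1_pos[OF d] using lt(1)[of n] by linarith
    qed
    hence "r ^ (2 * n + 1) * ((1 - r) / (1 - r ^ (2 * n + 1))) \<le> r ^ (2 * n + 1) * 1"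
      using assms by (intro mult_left_mono) auto
    also have "\<dots> \<le> r ^ n" using assms by (simp del: power_Suc add: power_decreasing)
    finally have "?f n - 1 \<le> r ^ n" unfolding eq by simp
    moreover show "0 \<le> ?f n - 1"
      unfolding eq using lt(1)[of n] assms
      by (intro divide_nonneg_nonneg mult_nonneg_nonneg zero_le_power) linarith+
    ultimately show "norm (?f n - 1) \<le> r ^ n" by simp
  qed
  have "summable (\<lambda>n. norm (?f n - 1))"
    by (rule summable_comparison_test'[of "\<lambda>n. r ^ n" 0]) (use assms bd in auto)
  hence "abs_convergent_prod ?f"
    by (simp add: abs_convergent_prod_conv_summable)
  thus c: "convergent_prod ?f" by (rule abs_convergent_prod_imp_convergent_prod)
  have "prodinf ?f \<ge> 1"
    using ge by (intro prodinf_nonneg[OF convergent_prod_has_prod[OF c]]) simp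
  thus "prodinf ?f > 0" by simp
qed

lemma phi_eq_infinity:
  assumes "p > 0" "a > 0" "0 < r" "r < 1" "b v = 0"
  shows "phi p a r b v = \<infinity>"
proof -
  define c where "c = p * sqrt (2 / pi) * (\<Prod>n. (1 - r ^ (2 * n + 2)) / (1 - r ^ (2 * n + 1)))"
  have "c > 0"
    unfolding c_def using assms phi_product_pos(2)[of r] by (intro mult_pos_pos) auto
  thus ?thesis
    unfolding phi_def c_def[symmetric] using assms by (simp add: esqrt_def ennreal_mult_top)
qed

end

theory Submission
  imports Defs
begin

text \<open>Leaves are eliminated one at a time. If \<open>L\<close> is a leaf with parent \<open>Q\<close>, its equation
  \<open>u\<^sub>L = \<phi>\<^sub>L(w, u\<^sub>L)\<close> has, for given ancestor values \<open>w\<close>, exactly one solution \<open>F(w)\<close>, because the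
  right-hand side is non-increasing and continuous in \<open>u\<^sub>L\<close>; moreover \<open>F\<close> is again continuous and
  non-increasing. Replacing \<open>\<phi>\<^sub>Q\<close> by \<open>\<phi>\<^sub>Q + F\<close> gives an equivalent system on the tree without \<open>L\<close>.
  This requires finite \<open>\<phi>\<close>, so \<open>\<beta>\<^sub>G\<close> is first replaced by \<open>max \<beta>\<^sub>G \<delta>\<^sub>G\<close> for a small constant
  \<open>\<delta>\<^sub>G > 0\<close>. This does not change the solutions: if \<open>\<beta>\<^sub>G < \<delta>\<^sub>G\<close> at a solution of either system, then
  class \<open>G\<close> alone contributes so much that all coordinates on the path to \<open>G\<close> are at least those of a point
  \<open>v\<close> with \<open>\<beta>\<^sub>G(v) \<ge> \<delta>\<^sub>G\<close>, which contradicts monotonicity.\<close>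

section \<open>Admissible functions and the abstract real-valued system\<close>

definition admissible :: "'a set \<Rightarrow> (('a \<Rightarrow> real) \<Rightarrow> real) \<Rightarrow> bool" where
  "admissible B f \<longleftrightarrow> f \<in> (B \<rightarrow>\<^sub>E {0..}) \<rightarrow> {0..} \<and> continuous_on (B \<rightarrow>\<^sub>E {0..}) f \<and>
     antimono_on (B \<rightarrow>\<^sub>E {0..}) f"

text \<open>The path sets \<open>D\<close> stay those of the full tree while \<open>S\<close>
  varies, and \<open>f\<close> is arbitrary because eliminating a leaf alters it. Extensionality
  fixes \<open>u\<close> off \<open>S\<close>, so that uniqueness can be stated as equality of
  functions.\<close>

definition load_solution ::
    "'a set \<Rightarrow> ('a \<Rightarrow> 'a set) \<Rightarrow> ('a \<Rightarrow> ('a \<Rightarrow> real) \<Rightarrow> real) \<Rightarrow> ('a \<Rightarrow> real) \<Rightarrow> bool" where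
  "load_solution S D f u \<longleftrightarrow> u \<in> S \<rightarrow>\<^sub>E {0..} \<and>
     (\<forall>H\<in>S. u H = (\<Sum>G | G \<in> S \<and> H \<in> D G. f G (restrict u (D G))))"

lemma admissible_nonneg: "admissible B f \<Longrightarrow> w \<in> B \<rightarrow>\<^sub>E {0..} \<Longrightarrow> 0 \<le> f w"
  unfolding admissible_def by (metis Pi_iff atLeast_iff)

lemma admissible_add:
  assumes "admissible B f" "admissible B g"
  shows "admissible B (\<lambda>w. f w + g w)"
  using assms unfolding admissible_def monotone_on_def
  by (auto intro!: continuous_on_add add_mono simp: Pi_iff)

section \<open>A scalar fixed point depending on parameters\<close>

lemma continuous_on_fun_upd_base:
  "continuous_on X (\<lambda>w. (w :: 'a \<Rightarrow> real)(L := b))"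
proof (rule continuous_on_coordinatewise_then_product)
  fix i
  show "continuous_on X (\<lambda>w. (w(L := b)) i)"
    by (cases "i = L") (auto intro: continuous_on_product_coordinates continuous_on_subset)
qed

lemma continuous_on_fun_upd_value:
  "continuous_on X (\<lambda>x. (w :: 'a \<Rightarrow> real)(L := x))"
proof (rule continuous_on_coordinatewise_then_product)
  fix i
  show "continuous_on X (\<lambda>x. (w(L := x)) i)"
    by (cases "i = L") (auto intro: continuous_on_id)
qed

text \<open>For fixed \<open>w\<close>, \<open>x - f (w(L := x))\<close> is strictly increasing in
  \<open>x\<close>, so it has at most one zero, and the intermediate value theorem yields one.
  Comparing \<open>F w\<close> with a constant \<open>b\<close> amounts to comparing
  \<open>f (w(L := b))\<close> with \<open>b\<close>; for fixed \<open>b\<close> this is an open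
  condition on \<open>w\<close>, which gives continuity of \<open>F\<close>.\<close>

lemma admissible_implicit_function:
  assumes f: "admissible (insert L B) f" and L: "L \<notin> B"
  obtains F where "admissible B F"
    "\<And>w x. w \<in> B \<rightarrow>\<^sub>E {0..} \<Longrightarrow> 0 \<le> x \<Longrightarrow> x = f (w(L := x)) \<longleftrightarrow> x = F w"
proof -
  define X :: "('a \<Rightarrow> real) set" where "X = B \<rightarrow>\<^sub>E {0..}"
  define Y :: "('a \<Rightarrow> real) set" where "Y = insert L B \<rightarrow>\<^sub>E {0..}"
  define h where "h w x = f (w(L := x))" for w x
  have Y: "w(L := x) \<in> Y" if "w \<in> X" "0 \<le> x" for w x
    using that unfolding X_def Y_def by (auto simp: PiE_iff extensional_def)
  have cont: "continuous_on Y f" and anti: "antimono_on Y f" and nn: "f \<in> Y \<rightarrow> {0..}"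
    using f unfolding admissible_def Y_def by auto
  have h_nonneg: "0 \<le> h w x" if "w \<in> X" "0 \<le> x" for w x
    using nn Y[OF that] unfolding h_def by auto
  have h_mono: "h w' x' \<le> h w x" if "w \<in> X" "w' \<in> X" "w \<le> w'" "0 \<le> x" "x \<le> x'" for w w' x x'
  proof -
    have "w(L := x) \<le> w'(L := x')" using that by (auto simp: le_fun_def)
    moreover have "w(L := x) \<in> Y" "w'(L := x') \<in> Y" using that by (auto intro!: Y)
    ultimately show ?thesis using anti unfolding h_def monotone_on_def by blast
  qed
  have h_cont_left: "continuous_on X (\<lambda>w. h w x)" if "0 \<le> x" for x
    unfolding h_def using Y that
    by (intro continuous_on_compose2[OF cont continuous_on_fun_upd_base]) auto
  have h_cont_right: "continuous_on {0..} (h w)" if "w \<in> X" for w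
    unfolding h_def using Y that
    by (intro continuous_on_compose2[OF cont continuous_on_fun_upd_value]) auto
  have ex: "\<exists>x\<ge>0. x = h w x" if w: "w \<in> X" for w
  proof -
    \<comment> \<open>As \<open>h w\<close> is non-increasing, \<open>h w b \<le> h w 0 = b\<close>,
      so \<open>x - h w x\<close> changes sign on \<open>[0, b]\<close>.\<close>
    define b where "b = h w 0"
    have b: "0 \<le> b" using h_nonneg[OF w] unfolding b_def by simp
    have "\<exists>x. 0 \<le> x \<and> x \<le> b \<and> x - h w x = 0"
    proof (rule IVT')
      show "0 - h w 0 \<le> 0" using h_nonneg[OF w] by simp
      show "0 \<le> b - h w b" using h_mono[OF w w order_refl _ b] unfolding b_def by simp
      show "continuous_on {0..b} (\<lambda>x. x - h w x)"
        by (intro continuous_intros continuous_on_subset[OF h_cont_right[OF w]]) auto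
    qed (rule b)
    thus ?thesis by auto
  qed
  have uniq: "x = y" if "w \<in> X" "0 \<le> x" "x = h w x" "0 \<le> y" "y = h w y" for w x y
  proof -
    have "x \<le> y" if "0 \<le> x" "x = h w x" "0 \<le> y" "y = h w y" for x y
      using h_mono[OF \<open>w \<in> X\<close> \<open>w \<in> X\<close> order_refl \<open>0 \<le> y\<close>, of x] that by linarith
    thus ?thesis using that by (meson order_antisym)
  qed
  define F where "F w = (SOME x. 0 \<le> x \<and> x = h w x)" for w
  have F: "0 \<le> F w" "F w = h w (F w)" if "w \<in> X" for w
    using someI_ex[of "\<lambda>x. 0 \<le> x \<and> x = h w x"] ex[OF that] unfolding F_def by auto
  \<comment> \<open>If \<open>b \<le> F w\<close>, then
    \<open>F w = h w (F w) \<le> h w b < b\<close>, a contradiction; \<open>F_greater\<close> is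
    symmetric.\<close>
  have F_less: "F w < b" if "w \<in> X" "0 \<le> b" "h w b < b" for w b
    using h_mono[OF that(1,1) order_refl that(2), of "F w"] F(2)[OF that(1)] that(3) by linarith
  have F_greater: "b < F w" if "w \<in> X" "0 \<le> b" "b < h w b" for w b
    using h_mono[OF that(1,1) order_refl F(1)[OF that(1)], of b] F(2)[OF that(1)] that(3)
    by linarith
  have F_mono: "F w' \<le> F w" if w: "w \<in> X" "w' \<in> X" "w \<le> w'" for w w'
  proof (rule ccontr)
    assume "\<not> F w' \<le> F w"
    hence "h w' (F w') \<le> h w (F w)" using w F by (intro h_mono) auto
    thus False using F(2)[OF w(1)] F(2)[OF w(2)] \<open>\<not> F w' \<le> F w\<close> by linarith
  qed
  have "continuous_on X F"
    unfolding continuous_on_def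
  proof
    fix w assume w: "w \<in> X"
    have in_X: "\<forall>\<^sub>F w' in at w within X. w' \<in> X"
      by (simp add: eventually_at_filter)
    have lim: "((\<lambda>w. h w b) \<longlongrightarrow> h w b) (at w within X)" if "0 \<le> b" for b
      using h_cont_left[OF that] w unfolding continuous_on_def by blast
    show "(F \<longlongrightarrow> F w) (at w within X)"
    proof (rule order_tendstoI)
      fix b assume b: "b < F w"
      show "\<forall>\<^sub>F w' in at w within X. b < F w'"
      proof (cases "0 \<le> b")
        case True
        \<comment> \<open>Here \<open>b < F w = h w (F w) \<le> h w b\<close>. The strict inequality
          persists for parameters near \<open>w\<close>, where it bounds \<open>F\<close> from
          below.\<close>
        have "b < h w b" using h_mono[OF w w order_refl True, of "F w"] F(2)[OF w] b by linarith
        hence "\<forall>\<^sub>F w' in at w within X. b < h w' b" by (rule order_tendstoD(1)[OF lim[OF True]])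
        thus ?thesis using in_X by eventually_elim (use F_greater True in blast)
      next
        case False
        show ?thesis using in_X by eventually_elim (use F(1) False in force)
      qed
    next
      fix b assume b: "F w < b"
      hence "0 \<le> b" using F(1)[OF w] by linarith
      have "h w b < b" using h_mono[OF w w order_refl F(1)[OF w], of b] F(2)[OF w] b by linarith
      hence "\<forall>\<^sub>F w' in at w within X. h w' b < b"
        by (rule order_tendstoD(2)[OF lim[OF \<open>0 \<le> b\<close>]])
      thus "\<forall>\<^sub>F w' in at w within X. F w' < b"
        using in_X by eventually_elim (use F_less \<open>0 \<le> b\<close> in blast)
    qed
  qed
  hence "admissible B F"
    unfolding admissible_def X_def[symmetric] monotone_on_def using F F_mono by auto
  moreover have "x = f (w(L := x)) \<longleftrightarrow> x = F w" if "w \<in> B \<rightarrow>\<^sub>E {0..}" "0 \<le> x" for w x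
    using F[of w] uniq[of w x "F w"] that unfolding X_def h_def by metis
  ultimately show thesis by (rule that)
qed

section \<open>Root paths and induction over leaves\<close>

lemma root_path_subset:
  assumes "rooted_tree T \<rho> E"
  shows "root_path E \<rho> G \<subseteq> T"
proof
  fix P assume "P \<in> root_path E \<rho> G"
  hence "(\<rho>, P) \<in> E\<^sup>*" by (simp add: root_path_def)
  thus "P \<in> T" by (induction) (use assms in \<open>auto simp: rooted_tree_def\<close>)
qed

lemma mem_root_path_iff:
  assumes "rooted_tree T \<rho> E" "H \<in> T"
  shows "H \<in> root_path E \<rho> G \<longleftrightarrow> (H, G) \<in> E\<^sup>*"
  using assms by (auto simp: root_path_def rooted_tree_def)

lemma root_path_root:
  assumes "rooted_tree T \<rho> E"
  shows "root_path E \<rho> \<rho> = {\<rho>}"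
  using assms by (auto simp: root_path_def rooted_tree_def elim: rtranclE)

text \<open>Any nontrivial path to \<open>L\<close> ends with the edge from its only parent
  \<open>Q\<close>.\<close>

lemma root_path_child:
  assumes tree: "rooted_tree T \<rho> E" and "(Q, L) \<in> E"
  shows "root_path E \<rho> L = insert L (root_path E \<rho> Q)"
proof -
  have L: "L \<in> T" "L \<noteq> \<rho>" "(\<rho>, L) \<in> E\<^sup>*" using assms by (auto simp: rooted_tree_def)
  hence "\<exists>!P. (P, L) \<in> E" using tree by (auto simp: rooted_tree_def)
  hence parent: "P = Q" if "(P, L) \<in> E" for P using that assms(2) by blast
  show ?thesis
    using L assms(2) by (auto simp: root_path_def elim: rtranclE dest: parent intro: rtrancl_into_rtrancl)
qed

text \<open>Take a maximal ancestor-closed \<open>S\<close> containing the root and satisfying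
  \<open>P\<close>. If \<open>S\<close> were not all of \<open>T\<close>, some path from the root
  would leave \<open>S\<close> along an edge from \<open>Q\<close> to \<open>L\<close>, and adding
  \<open>L\<close> would contradict maximality. Since \<open>S\<close> is ancestor-closed,
  \<open>L\<close> is a leaf of the enlarged set.\<close>

lemma rooted_tree_leaf_induct [consumes 2, case_names root leaf]:
  assumes "finite T" and tree: "rooted_tree T \<rho> E"
    and root: "P {\<rho>}"
    and leaf: "\<And>S Q L. S \<subseteq> T \<Longrightarrow> (\<And>G. G \<in> S \<Longrightarrow> root_path E \<rho> G \<subseteq> S) \<Longrightarrow>
      Q \<in> S \<Longrightarrow> L \<in> T - S \<Longrightarrow> (Q, L) \<in> E \<Longrightarrow> P S \<Longrightarrow> P (insert L S)"
  shows "P T"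
proof -
  define good where
    "good S \<longleftrightarrow> S \<subseteq> T \<and> \<rho> \<in> S \<and> (\<forall>G\<in>S. root_path E \<rho> G \<subseteq> S) \<and> P S" for S
  have "good {\<rho>}"
    using root tree root_path_root[OF tree] by (auto simp: good_def rooted_tree_def)
  hence "{S. good S} \<noteq> {}" by blast
  moreover have "finite {S. good S}"
    by (rule finite_subset[of _ "Pow T"]) (use \<open>finite T\<close> in \<open>auto simp: good_def\<close>)
  ultimately have "\<exists>S\<in>{S. good S}. \<forall>S'\<in>{S. good S}. S \<subseteq> S' \<longrightarrow> S = S'"
    by (intro finite_has_maximal)
  then obtain S where S: "good S" and max: "\<And>S'. good S' \<Longrightarrow> S \<subseteq> S' \<Longrightarrow> S' = S"
    by auto
  have "G \<in> S" if "(\<rho>, G) \<in> E\<^sup>*" for G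
    using that
  proof induction
    case base
    show ?case using S by (simp add: good_def)
  next
    case (step Q L)
    show ?case
    proof (rule ccontr)
      assume "L \<notin> S"
      moreover have "L \<in> T" using step tree by (auto simp: rooted_tree_def)
      ultimately have "P (insert L S)"
        using S step by (intro leaf[of S Q L]) (auto simp: good_def)
      hence "good (insert L S)"
        using S step \<open>L \<in> T\<close> root_path_child[OF tree step(2)] by (fastforce simp: good_def)
      thus False using max[of "insert L S"] \<open>L \<notin> S\<close> by blast
    qed
  qed
  hence "S = T" using S tree by (auto simp: good_def rooted_tree_def)
  thus ?thesis using S by (simp add: good_def)
qed

section \<open>Elimination of a leaf and solution of the abstract system\<close>

text \<open>Within \<open>S\<close>, classes \<open>L\<close> and \<open>Q\<close> use exactly the
  same nodes. Once the equation at \<open>L\<close> is solved by \<open>F\<close>, the load of class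
  \<open>L\<close> can therefore be charged to class \<open>Q\<close>.\<close>

lemma load_solution_insert_leaf:
  assumes fin: "finite S" and L: "L \<notin> S" and closed: "\<And>G. G \<in> S \<Longrightarrow> D G \<subseteq> S"
    and Q: "Q \<in> S" and DL: "D L = insert L (D Q)"
    and F: "\<And>w x. w \<in> D Q \<rightarrow>\<^sub>E {0..} \<Longrightarrow> 0 \<le> x \<Longrightarrow> x = f L (w(L := x)) \<longleftrightarrow> x = F w"
  shows "load_solution (insert L S) D f u \<longleftrightarrow>
    u \<in> insert L S \<rightarrow>\<^sub>E {0..} \<and> u L = F (restrict u (D Q)) \<and>
    load_solution S D (f(Q := \<lambda>w. f Q w + F w)) (restrict u S)"
proof (cases "u \<in> insert L S \<rightarrow>\<^sub>E {0..}")
  case True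
  let ?f = "f(Q := \<lambda>w. f Q w + F w)"
  have "L \<notin> D Q" using closed[OF Q] L by blast
  hence upd: "restrict u (D L) = (restrict u (D Q))(L := u L)"
    unfolding DL by (auto simp: fun_eq_iff)
  have "restrict u (D Q) \<in> D Q \<rightarrow>\<^sub>E {0..}" "0 \<le> u L"
    using True closed[OF Q] by (auto simp: PiE_iff)
  from F[OF this] have leaf_iff: "u L = f L (restrict u (D L)) \<longleftrightarrow> u L = F (restrict u (D Q))"
    unfolding upd .
  \<comment> \<open>No class of \<open>S\<close> reaches the leaf, so the equation at
    \<open>L\<close> has a single term.\<close>
  have "{G. G \<in> insert L S \<and> L \<in> D G} = {L}" using closed L DL by auto
  hence eq_L: "(\<Sum>G | G \<in> insert L S \<and> L \<in> D G. f G (restrict u (D G))) = f L (restrict u (D L))"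
    by simp
  have eq_S: "(\<Sum>G | G \<in> insert L S \<and> H \<in> D G. f G (restrict u (D G))) =
      (\<Sum>G | G \<in> S \<and> H \<in> D G. ?f G (restrict (restrict u S) (D G)))"
    if H: "H \<in> S" and uL: "f L (restrict u (D L)) = F (restrict u (D Q))" for H
  proof -
    have "(\<Sum>G | G \<in> S \<and> H \<in> D G. ?f G (restrict (restrict u S) (D G))) =
        (\<Sum>G\<in>S. if H \<in> D G then ?f G (restrict (restrict u S) (D G)) else 0)"
      by (rule sum.inter_filter[OF fin])
    \<comment> \<open>The added \<open>F\<close> is split off as a term supported at
      \<open>G = Q\<close>, so that its sum collapses.\<close>
    also have "\<dots> = (\<Sum>G\<in>S. (if H \<in> D G then f G (restrict u (D G)) else 0) +
        (if G = Q then if H \<in> D Q then F (restrict u (D Q)) else 0 else 0))"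
    proof (rule sum.cong)
      fix G assume "G \<in> S"
      hence "restrict (restrict u S) (D G) = restrict u (D G)"
        using closed by (simp add: Int_absorb1)
      thus "(if H \<in> D G then ?f G (restrict (restrict u S) (D G)) else 0) =
        (if H \<in> D G then f G (restrict u (D G)) else 0) +
        (if G = Q then if H \<in> D Q then F (restrict u (D Q)) else 0 else 0)"
        by simp
    qed simp
    also have "\<dots> = (\<Sum>G\<in>S. if H \<in> D G then f G (restrict u (D G)) else 0) +
        (if H \<in> D Q then F (restrict u (D Q)) else 0)"
      using fin Q by (simp add: sum.distrib)
    \<comment> \<open>By \<open>uL\<close> the collapsed term is the summand of class
      \<open>L\<close>: as \<open>H \<noteq> L\<close>, membership in \<open>D L\<close> and in
      \<open>D Q\<close> coincide.\<close>
    also have "\<dots> = (\<Sum>G\<in>insert L S. if H \<in> D G then f G (restrict u (D G)) else 0)"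
      using fin L H uL DL by auto
    also have "\<dots> = (\<Sum>G | G \<in> insert L S \<and> H \<in> D G. f G (restrict u (D G)))"
      using fin by (intro sum.inter_filter[symmetric]) simp
    finally show ?thesis ..
  qed
  have "restrict u S \<in> S \<rightarrow>\<^sub>E {0..}" using True by (auto simp: PiE_iff)
  thus ?thesis
    using True leaf_iff eq_L eq_S unfolding load_solution_def by (auto simp del: fun_upd_apply)
next
  case False
  thus ?thesis by (simp add: load_solution_def)
qed

lemma load_solution_ex1:
  assumes "finite T" and tree: "rooted_tree T \<rho> E"
    and "\<And>G. G \<in> T \<Longrightarrow> admissible (root_path E \<rho> G) (f G)"
  shows "\<exists>!u. load_solution T (root_path E \<rho>) f u"
  using assms
proof (induction arbitrary: f rule: rooted_tree_leaf_induct)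
  case root
  \<comment> \<open>The root has no proper ancestors, so the parameter space is
    \<open>{} \<rightarrow>\<^sub>E {0..}\<close>, whose only point is \<open>?w\<close>.\<close>
  let ?D = "root_path E \<rho>" and ?w = "(\<lambda>_. undefined) :: 'a \<Rightarrow> real"
  have D: "?D \<rho> = {\<rho>}" by (rule root_path_root[OF tree])
  hence "admissible (insert \<rho> {}) (f \<rho>)" using root by force
  then obtain F where F: "admissible {} F"
    "\<And>w x. w \<in> {} \<rightarrow>\<^sub>E {0..} \<Longrightarrow> 0 \<le> x \<Longrightarrow> x = f \<rho> (w(\<rho> := x)) \<longleftrightarrow> x = F w"
    using admissible_implicit_function[of \<rho> "{}" "f \<rho>"] by blast
  have "0 \<le> F ?w" by (rule admissible_nonneg[OF F(1)]) simp
  have "{G. G = \<rho> \<and> \<rho> \<in> ?D G} = {\<rho>}" using D by auto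
  hence iff: "load_solution {\<rho>} ?D f u \<longleftrightarrow> u \<in> {\<rho>} \<rightarrow>\<^sub>E {0..} \<and> u \<rho> = f \<rho> (restrict u {\<rho>})" for u
    by (simp add: load_solution_def D)
  have "load_solution {\<rho>} ?D f u \<longleftrightarrow> u = ?w(\<rho> := F ?w)" for u
  proof (cases "u \<in> {\<rho>} \<rightarrow>\<^sub>E {0..}")
    case True
    hence u: "?w(\<rho> := u \<rho>) = u" "restrict u {\<rho>} = u" "0 \<le> u \<rho>"
      by (auto simp: PiE_iff extensional_def fun_eq_iff)
    have "load_solution {\<rho>} ?D f u \<longleftrightarrow> u \<rho> = F ?w"
      using F(2)[of ?w "u \<rho>"] u True by (simp add: iff)
    thus ?thesis using u(1) by (metis fun_upd_same)
  next
    case False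
    moreover have "?w(\<rho> := F ?w) \<in> {\<rho>} \<rightarrow>\<^sub>E {0..}"
      using \<open>0 \<le> F ?w\<close> by (auto simp: PiE_iff extensional_def)
    ultimately show ?thesis using iff by blast
  qed
  thus ?case by simp
next
  case (leaf S Q L)
  let ?D = "root_path E \<rho>"
  have fin: "finite S" using leaf(1) \<open>finite T\<close> finite_subset by blast
  have DL: "?D L = insert L (?D Q)" by (rule root_path_child[OF tree leaf(5)])
  have L: "L \<notin> S" "L \<notin> ?D Q" using leaf by auto
  have "admissible (insert L (?D Q)) (f L)" using leaf(7)[of L] DL by simp
  then obtain F where F: "admissible (?D Q) F"
    "\<And>w x. w \<in> ?D Q \<rightarrow>\<^sub>E {0..} \<Longrightarrow> 0 \<le> x \<Longrightarrow> x = f L (w(L := x)) \<longleftrightarrow> x = F w"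
    using admissible_implicit_function[OF _ L(2)] by blast
  let ?f = "f(Q := \<lambda>w. f Q w + F w)"
  \<comment> \<open>The modified family is again admissible, so the induction hypothesis, which is
    general in \<open>f\<close>, applies to it.\<close>
  have "admissible (?D G) (?f G)" if "G \<in> S" for G
    using leaf(7)[of G] F(1) that by (auto intro: admissible_add)
  from leaf(6)[OF this] obtain v where v: "load_solution S ?D ?f v"
    and v_unique: "\<And>v'. load_solution S ?D ?f v' \<Longrightarrow> v' = v"
    by blast
  note insert_iff = load_solution_insert_leaf
    [where f = f and F = F, OF fin L(1) leaf(2) leaf(3) DL F(2)]
  \<comment> \<open>The solution on \<open>S\<close> determines the leaf value through
    \<open>F\<close>.\<close>
  let ?u = "v(L := F (restrict v (?D Q)))"
  show ?case
  proof (rule ex1I)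
    have vS: "v \<in> S \<rightarrow>\<^sub>E {0..}" using v by (simp add: load_solution_def)
    have "restrict v (?D Q) \<in> ?D Q \<rightarrow>\<^sub>E {0..}" using vS leaf(2)[OF leaf(3)] by (auto simp: PiE_iff)
    hence "0 \<le> F (restrict v (?D Q))" by (rule admissible_nonneg[OF F(1)])
    hence "?u \<in> insert L S \<rightarrow>\<^sub>E {0..}" using vS by (auto simp: PiE_iff extensional_def)
    moreover have "restrict ?u S = v" "restrict ?u (?D Q) = restrict v (?D Q)"
      using vS L by (auto simp: fun_eq_iff PiE_iff extensional_def)
    ultimately show "load_solution (insert L S) ?D f ?u" using insert_iff v by simp
  next
    fix u assume "load_solution (insert L S) ?D f u"
    hence u: "u \<in> insert L S \<rightarrow>\<^sub>E {0..}" "u L = F (restrict u (?D Q))" "restrict u S = v"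
      using insert_iff v_unique by blast+
    have "restrict v (?D Q) = restrict u (?D Q)"
      using leaf(2)[OF leaf(3)] unfolding u(3)[symmetric] by (simp add: Int_absorb1)
    moreover have "u x = v x" if "x \<noteq> L" for x
      using u(1) that unfolding u(3)[symmetric]
      by (cases "x \<in> S") (auto simp: PiE_iff extensional_def)
    ultimately show "u = ?u" using u(2) by (intro ext) simp
  qed
qed

section \<open>Reduction of the extended-valued system to a truncated real one\<close>

theorem proposition3:
  fixes T :: "'a set" and \<rho> :: 'a and E :: "('a \<times> 'a) set"
    and p a r :: "'a \<Rightarrow> real"
    and \<beta> :: "'a \<Rightarrow> ('a \<Rightarrow> real) \<Rightarrow> real"
  assumes "finite T" and "rooted_tree T \<rho> E"
    and "\<And>G. G \<in> T \<Longrightarrow> p G \<ge> 0" and "(\<Sum>G\<in>T. p G) = 1"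
    and "\<And>G. G \<in> T \<Longrightarrow> a G \<ge> 0"
    and "\<And>G. G \<in> T \<Longrightarrow> r G \<in> {0<..<1}"
    and "\<And>G. G \<in> T \<Longrightarrow> \<beta> G \<in> (root_path E \<rho> G \<rightarrow>\<^sub>E {0..}) \<rightarrow> {0..}"
    and "\<And>G. G \<in> T \<Longrightarrow> continuous_on (root_path E \<rho> G \<rightarrow>\<^sub>E {0..}) (\<beta> G)"
    and "\<And>G. G \<in> T \<Longrightarrow> mono_on (root_path E \<rho> G \<rightarrow>\<^sub>E {0..}) (\<beta> G)"
    and "\<And>G. G \<in> T \<Longrightarrow> p G > 0 \<Longrightarrow> a G > 0 \<Longrightarrow>
           \<exists>v \<in> root_path E \<rho> G \<rightarrow>\<^sub>E {0..}. \<beta> G v > 0"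
  shows "\<exists>!u. u \<in> T \<rightarrow>\<^sub>E {0..} \<and>
           (\<forall>H\<in>T. ennreal (u H) =
              (\<Sum>G | G \<in> T \<and> (H, G) \<in> E\<^sup>*.
                 phi (p G) (a G) (r G) (\<beta> G) (restrict u (root_path E \<rho> G))))"
proof -
  let ?D = "root_path E \<rho>"
  let ?phi = "\<lambda>G. phi (p G) (a G) (r G) (\<beta> G)"
  define c where "c G = p G * sqrt (2 / pi) *
    (\<Prod>n. (1 - r G ^ (2 * n + 2)) / (1 - r G ^ (2 * n + 1)))" for G
  have c_nonneg: "0 \<le> c G" if "G \<in> T" for G
    unfolding c_def using assms(3)[OF that] assms(6)[OF that] phi_product_pos(2)[of "r G"]
    by (intro mult_nonneg_nonneg) auto
  have c_pos: "0 < c G" if "G \<in> T" "0 < p G" for G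
    unfolding c_def using that assms(6)[of G] phi_product_pos(2)[of "r G"]
    by (intro mult_pos_pos) auto
  have D_sub: "?D G \<subseteq> T" for G by (rule root_path_subset[OF assms(2)])
  have fin_D: "finite (?D G)" for G using D_sub assms(1) finite_subset by blast

  \<comment> \<open>The cutoff \<open>d\<close> is so small that a class whose rate is
    \<open>d\<close> already sends a load dominating some \<open>v\<close> with
    \<open>\<beta> G v \<ge> d\<close>. Such a \<open>v\<close> needs a point of positive loss rate;
    if \<open>\<beta> G\<close> vanished identically with \<open>p G\<close> and \<open>a G\<close>
    positive, \<open>phi\<close> would be infinite everywhere.\<close>
  have "\<exists>d. 0 < d \<and> (0 < p G \<longrightarrow> 0 < a G \<longrightarrow>
      (\<exists>v \<in> ?D G \<rightarrow>\<^sub>E {0..}. d \<le> \<beta> G v \<and> (\<forall>P\<in>?D G. v P \<le> c G * sqrt (a G / d))))"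
    if G: "G \<in> T" for G
  proof (cases "0 < p G \<and> 0 < a G")
    case True
    then obtain v where v: "v \<in> ?D G \<rightarrow>\<^sub>E {0..}" "0 < \<beta> G v" using assms(10)[OF G] by blast
    \<comment> \<open>\<open>M\<close> bounds every coordinate of \<open>v\<close>; the summand 1
      makes it positive, so that division by it is possible.\<close>
    define M where "M = 1 + sum v (?D G)"
    have vP: "0 \<le> v P" if "P \<in> ?D G" for P using v that by (auto simp: PiE_iff)
    have M: "0 < M" unfolding M_def using sum_nonneg[of "?D G" v] vP by simp
    have vM: "v P \<le> M" if "P \<in> ?D G" for P
      unfolding M_def using member_le_sum[of P "?D G" v] vP fin_D that by fastforce
    have c: "0 < c G" using c_pos G True by blast
    \<comment> \<open>The second argument of \<open>min\<close> is the rate at which the load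
      \<open>c G * sqrt (a G / d)\<close> equals \<open>M\<close>; a smaller \<open>d\<close> only
      increases this load.\<close>
    define d where "d = min (\<beta> G v) (a G / (M / c G)\<^sup>2)"
    have d: "0 < d" unfolding d_def using v True M c by simp
    have "(M / c G)\<^sup>2 \<le> a G / d"
    proof -
      have "d \<le> a G / (M / c G)\<^sup>2" unfolding d_def by simp
      thus ?thesis using d M c by (simp add: field_simps)
    qed
    hence "M / c G \<le> sqrt (a G / d)" by (rule real_le_rsqrt)
    hence "M \<le> c G * sqrt (a G / d)" using c by (simp add: field_simps)
    hence "\<forall>P\<in>?D G. v P \<le> c G * sqrt (a G / d)" using vM by force
    moreover have "d \<le> \<beta> G v" unfolding d_def by simp
    ultimately show ?thesis using d v by blast
  next
    case False
    \<comment> \<open>Such a class contributes nothing, so any positive cutoff will do.\<close>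
    thus ?thesis by (intro exI[of _ 1]) auto
  qed
  then obtain d where d: "\<And>G. G \<in> T \<Longrightarrow> 0 < d G"
    and d_witness: "\<And>G. G \<in> T \<Longrightarrow> 0 < p G \<Longrightarrow> 0 < a G \<Longrightarrow>
      \<exists>v \<in> ?D G \<rightarrow>\<^sub>E {0..}. d G \<le> \<beta> G v \<and> (\<forall>P\<in>?D G. v P \<le> c G * sqrt (a G / d G))"
    by metis

  define f where "f G w = c G * sqrt (a G / max (\<beta> G w) (d G))" for G w
  have adm: "admissible (?D G) (f G)" if G: "G \<in> T" for G
    unfolding admissible_def
  proof (intro conjI)
    have pos: "0 < max (\<beta> G w) (d G)" for w using d[OF G] by simp
    show "f G \<in> (?D G \<rightarrow>\<^sub>E {0..}) \<rightarrow> {0..}"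
      unfolding f_def using c_nonneg[OF G] assms(5)[OF G] less_imp_le[OF pos] by auto
    show "continuous_on (?D G \<rightarrow>\<^sub>E {0..}) (f G)"
      unfolding f_def using assms(8)[OF G] pos
      by (intro continuous_intros) (auto simp: less_le)
    show "antimono_on (?D G \<rightarrow>\<^sub>E {0..}) (f G)"
    proof (rule monotone_onI)
      fix w w' :: "'a \<Rightarrow> real"
      assume "w \<in> ?D G \<rightarrow>\<^sub>E {0..}" "w' \<in> ?D G \<rightarrow>\<^sub>E {0..}" "w \<le> w'"
      hence "\<beta> G w \<le> \<beta> G w'" using assms(9)[OF G] by (auto simp: monotone_on_def)
      hence "a G / max (\<beta> G w') (d G) \<le> a G / max (\<beta> G w) (d G)"
        using assms(5)[OF G] pos by (intro divide_left_mono mult_pos_pos) auto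
      thus "f G w' \<le> f G w"
        unfolding f_def using c_nonneg[OF G] by (intro mult_left_mono real_sqrt_le_mono)
    qed
  qed
  have f_nonneg: "0 \<le> f G (restrict u (?D G))" if "u \<in> T \<rightarrow>\<^sub>E {0..}" "G \<in> T" for u G
  proof -
    have "restrict u (?D G) \<in> ?D G \<rightarrow>\<^sub>E {0..}" using that D_sub[of G] by (auto simp: PiE_iff)
    thus ?thesis by (rule admissible_nonneg[OF adm[OF that(2)]])
  qed

  \<comment> \<open>The disjunction lets one argument serve both systems: a solution of the original
    one dominates \<open>phi\<close> along the path, a solution of the truncated one dominates
    \<open>f\<close>.\<close>
  have phi_eq_f: "?phi G (restrict u (?D G)) = ennreal (f G (restrict u (?D G)))"
    if u: "u \<in> T \<rightarrow>\<^sub>E {0..}" and G: "G \<in> T"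
      and le: "\<And>P. P \<in> ?D G \<Longrightarrow> ?phi G (restrict u (?D G)) \<le> ennreal (u P)
        \<or> f G (restrict u (?D G)) \<le> u P" for u G
  proof (cases "0 < p G \<and> 0 < a G")
    case False
    hence "p G = 0 \<or> a G = 0" using assms(3)[OF G] assms(5)[OF G] by linarith
    thus ?thesis using phi_eq_0[of "p G" "a G" "r G" "\<beta> G"] by (auto simp: f_def c_def)
  next
    case True
    let ?w = "restrict u (?D G)"
    have w: "?w \<in> ?D G \<rightarrow>\<^sub>E {0..}" using u D_sub[of G] by (auto simp: PiE_iff)
    hence \<beta>_nonneg: "0 \<le> \<beta> G ?w" using assms(7)[OF G] by (metis Pi_iff atLeast_iff)
    have "d G \<le> \<beta> G ?w"
    \<comment> \<open>Below the cutoff, \<open>f\<close> equals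
      \<open>c G * sqrt (a G / d G)\<close> and is at most \<open>phi\<close>. Either disjunct then
      puts \<open>u\<close> above the witness \<open>v\<close> on the whole path, and monotonicity
      gives \<open>\<beta> G ?w \<ge> \<beta> G v \<ge> d G\<close>.\<close>
    proof (rule ccontr)
      assume less: "\<not> d G \<le> \<beta> G ?w"
      hence f: "f G ?w = c G * sqrt (a G / d G)" by (simp add: f_def)
      have "ennreal (f G ?w) \<le> ?phi G ?w"
      proof (cases "\<beta> G ?w = 0")
        case True
        thus ?thesis
          using \<open>0 < p G \<and> 0 < a G\<close> assms(6)[OF G] phi_eq_infinity[of "p G" "a G" "r G" "\<beta> G" ?w]
          by auto
      next
        case False
        hence pos: "0 < \<beta> G ?w" using \<beta>_nonneg by simp
        hence "sqrt (a G / d G) \<le> sqrt (a G / \<beta> G ?w)"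
          using less True by (intro real_sqrt_le_mono divide_left_mono) auto
        hence "f G ?w \<le> c G * sqrt (a G / \<beta> G ?w)"
          unfolding f using c_nonneg[OF G] by (intro mult_left_mono)
        thus ?thesis
          using True pos by (simp add: phi_eq_real c_def ennreal_leI)
      qed
      hence f_le: "f G ?w \<le> u P" if P: "P \<in> ?D G" for P
      proof -
        have "0 \<le> u P" using u D_sub[of G] P by (auto simp: PiE_iff)
        thus ?thesis
          using le[OF P] \<open>ennreal (f G ?w) \<le> ?phi G ?w\<close> order_trans ennreal_le_iff by blast
      qed
      obtain v where v: "v \<in> ?D G \<rightarrow>\<^sub>E {0..}" "d G \<le> \<beta> G v" "\<forall>P\<in>?D G. v P \<le> f G ?w"
        using d_witness[OF G] True f by metis
      have "v \<le> ?w"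
      proof (rule le_funI)
        \<comment> \<open>Off the path both functions are \<open>undefined\<close>, so the order on
          all of \<open>'a\<close> reduces to the path.\<close>
        fix P show "v P \<le> ?w P"
          using v f_le[of P] by (cases "P \<in> ?D G") (force simp: PiE_iff extensional_def)+
      qed
      hence "\<beta> G v \<le> \<beta> G ?w" using assms(9)[OF G] v w by (auto simp: monotone_on_def)
      thus False using v less by linarith
    qed
    thus ?thesis
      using True d[OF G] by (simp add: phi_eq_real f_def c_def max_def)
  qed

  have filter: "{G. G \<in> T \<and> H \<in> ?D G} = {G. G \<in> T \<and> (H, G) \<in> E\<^sup>*}" if "H \<in> T" for H
    using mem_root_path_iff[OF assms(2) that] by simp
  have "(\<forall>H\<in>T. ennreal (u H) =
        (\<Sum>G | G \<in> T \<and> (H, G) \<in> E\<^sup>*. ?phi G (restrict u (?D G)))) \<longleftrightarrow>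
      (\<forall>H\<in>T. u H = (\<Sum>G | G \<in> T \<and> H \<in> ?D G. f G (restrict u (?D G))))"
    (is "?lhs \<longleftrightarrow> ?rhs") if u: "u \<in> T \<rightarrow>\<^sub>E {0..}" for u
  proof -
    \<comment> \<open>The equations agree once all terms do; each direction below first derives this
      from its own system, where every nonnegative summand is at most the total
      \<open>u P\<close>.\<close>
    have sum_iff: "ennreal (u H) = (\<Sum>G | G \<in> T \<and> (H, G) \<in> E\<^sup>*. ?phi G (restrict u (?D G))) \<longleftrightarrow>
        u H = (\<Sum>G | G \<in> T \<and> H \<in> ?D G. f G (restrict u (?D G)))"
      if eq: "\<And>G. G \<in> T \<Longrightarrow> ?phi G (restrict u (?D G)) = ennreal (f G (restrict u (?D G)))"
        and H: "H \<in> T" for H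
    proof -
      have "(\<Sum>G | G \<in> T \<and> (H, G) \<in> E\<^sup>*. ?phi G (restrict u (?D G))) =
          ennreal (\<Sum>G | G \<in> T \<and> H \<in> ?D G. f G (restrict u (?D G)))"
        unfolding filter[OF H] using f_nonneg[OF u]
        by (subst sum_ennreal[symmetric]) (auto intro!: sum.cong eq)
      moreover have "0 \<le> u H" using u H by (auto simp: PiE_iff)
      moreover have "0 \<le> (\<Sum>G | G \<in> T \<and> H \<in> ?D G. f G (restrict u (?D G)))"
        using f_nonneg[OF u] by (auto intro: sum_nonneg)
      ultimately show ?thesis by simp
    qed
    show ?thesis
    proof
      assume ?lhs
      have "?phi G (restrict u (?D G)) = ennreal (f G (restrict u (?D G)))" if G: "G \<in> T" for G
      proof (rule phi_eq_f[OF u G], rule disjI1)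
        fix P assume P: "P \<in> ?D G"
        hence "P \<in> T" using D_sub by blast
        have "?phi G (restrict u (?D G)) \<le>
            (\<Sum>G | G \<in> T \<and> (P, G) \<in> E\<^sup>*. ?phi G (restrict u (?D G)))"
          using P G assms(1) unfolding filter[OF \<open>P \<in> T\<close>, symmetric]
          by (intro member_le_sum) auto
        thus "?phi G (restrict u (?D G)) \<le> ennreal (u P)" using \<open>?lhs\<close> \<open>P \<in> T\<close> by simp
      qed
      thus ?rhs using sum_iff \<open>?lhs\<close> by blast
    next
      assume ?rhs
      have "?phi G (restrict u (?D G)) = ennreal (f G (restrict u (?D G)))" if G: "G \<in> T" for G
      proof (rule phi_eq_f[OF u G], rule disjI2)
        fix P assume P: "P \<in> ?D G"
        hence "P \<in> T" using D_sub by blast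
        have "f G (restrict u (?D G)) \<le> (\<Sum>G | G \<in> T \<and> P \<in> ?D G. f G (restrict u (?D G)))"
          using P G assms(1) f_nonneg[OF u] by (intro member_le_sum) auto
        thus "f G (restrict u (?D G)) \<le> u P" using \<open>?rhs\<close> \<open>P \<in> T\<close> by simp
      qed
      thus ?lhs using sum_iff \<open>?rhs\<close> by blast
    qed
  qed
  hence "load_solution T ?D f u \<longleftrightarrow> u \<in> T \<rightarrow>\<^sub>E {0..} \<and> (\<forall>H\<in>T. ennreal (u H) =
      (\<Sum>G | G \<in> T \<and> (H, G) \<in> E\<^sup>*. ?phi G (restrict u (?D G))))" for u
    unfolding load_solution_def by blast
  thus ?thesis using load_solution_ex1[OF assms(1,2) adm] by simp
qed

end
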